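(* Let $X=X_\Sigma$ be the $n$-dimensional toric variety of a complete fan $\Sigma$ in $\mathbb{R}^n$ with $k$ rays, and let $f=\sum_\ell f_\ell x^\ell$, $g=\sum_\ell g_\ell x^\ell$ in $S=\mathbb{C}[x_1,\dots,x_k]$ be nonzero homogeneous polynomials with positive coefficients and the same degree in $\mathrm{Cl}(X)$, with $\dim\mathcal{N}(g)=n$ and $\mathcal{N}(f)$ contained in the relative interior of $\mathcal{N}(g)$. Let $h=\frac{f\cdot g^{\rm tr}}{g\cdot f^{\rm tr}}$ on $X_{>0}$ and $$M_1=\frac{\min_{\ell\in\mathrm{supp}(f)}f_\ell}{\sum_{\ell\in\mathrm{supp}(g)}g_\ell},\qquad M_2=\frac{\sum_{\ell\in\mathrm{supp}(f)}f_\ell}{\min_{\ell\in\mathrm{supp}(g)}g_\ell}.$$ Consider the rejection sampling procedure in which $x\in X_{>0}$ is drawn from $\mu^{\rm tr}_{f,g}=\frac{1}{\mathcal{I}^{\rm tr}}\frac{f^{\rm tr}}{g^{\rm tr}}\Omega_X$, $\xi$ is drawn independently and uniformly from $[0,M_2]$, and the sample $x$ is accepted if $\xi<h(x)$ and rejected otherwise. Then the acceptance rate, i.e. the probability that $\xi<h(x)$, is at least $M_1/M_2$.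
   Context: Let $\Sigma$ be a complete rational polyhedral fan in $\mathbb{R}^n$ with primitive ray generators $v_1,\dots,v_k\in\mathbb{Z}^n$, and $V=[v_1\,\cdots\,v_k]\in\mathbb{Z}^{n\times k}$. Let $X=X_\Sigma$ be the associated toric variety with dense torus $T=(\mathbb{C}^* )^n$ (coordinates $t_j$). The Cox ring $S=\mathbb{C}[x_1,\dots,x_k]$ is graded by $\mathrm{Cl}(X)=\mathbb{Z}^k/\mathrm{im}(V^\top)$ with $\deg x_i$ the class of the $i$-th unit vector. The Cox quotient map $\pi$ is given on $(\mathbb{C}^* )^k$ by $x\mapsto(\prod_i x_i^{(v_i)_j})_{j=1,\dots,n}\in T$, and $X_{>0}=\pi(\mathbb{R}^k_{>0})\simeq\mathbb{R}^n_{>0}$. The canonical form is $\Omega_X=\sum_{|I|=n}\det(V_I)\bigwedge_{i\in I}\frac{\mathrm{d}x_i}{x_i}$; it is the pullback under $\pi$ of $\bigwedge_{j=1}^n\mathrm{d}t_j/t_j$, is viewed as a form on $X$, and $X_{>0}$ is oriented so that it is positive. For a polynomial $f$ with positive coefficients, $\mathrm{supp}(f)$ is its set of exponent vectors, $\mathcal{N}(f)\subset\mathbb{R}^k$ its Newton polytope, and $f^{\rm tr}(x)=\max_{\ell\in\mathrm{supp}(f)}x^\ell$ for $x\in\mathbb{R}^k_{>0}$. The functions $f/g$, $f^{\rm tr}/g^{\rm tr}$ and $h$ are constant on the fibres of $\pi:\mathbb{R}^k_{>0}\to X_{>0}$ and are viewed as functions on $X_{>0}$. $\mathcal{I}^{\rm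 tr}=\int_{X_{>0}}\frac{f^{\rm tr}}{g^{\rm tr}}\Omega_X$, which is finite and positive under the stated hypotheses, so $\mu^{\rm tr}_{f,g}$ is a probability measure on $X_{>0}$. *)

theory Defs
  imports "HOL-Probability.Probability" "HOL-Library.Poly_Mapping"
begin

section \<open>Complete rational fans\<close>

definition real_vec :: "int^'n \<Rightarrow> real^'n" where
  "real_vec u = (\<chi> j. real_of_int (u $ j))"

definition rational_polyhedral_cone :: "(real^'n) set \<Rightarrow> bool" where
  "rational_polyhedral_cone \<sigma> \<longleftrightarrow> (\<exists>S. finite S \<and> \<sigma> = convex_cone hull (real_vec ` S))"

definition strongly_convex :: "(real^'n) set \<Rightarrow> bool" where
  "strongly_convex \<sigma> \<longleftrightarrow> \<sigma> \<inter> uminus ` \<sigma> = {0}"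

text \<open>The library relation \<open>face_of\<close> counts the empty set as a face; faces of cones in a fan are
  nonempty.\<close>

definition rational_fan :: "(real^'n) set set \<Rightarrow> bool" where
  "rational_fan \<F> \<longleftrightarrow> finite \<F> \<and> \<F> \<noteq> {} \<and>
     (\<forall>\<sigma>\<in>\<F>. rational_polyhedral_cone \<sigma> \<and> strongly_convex \<sigma>) \<and>
     (\<forall>\<sigma>\<in>\<F>. \<forall>\<tau>. \<tau> face_of \<sigma> \<and> \<tau> \<noteq> {} \<longrightarrow> \<tau> \<in> \<F>) \<and>
     (\<forall>\<sigma>\<in>\<F>. \<forall>\<tau>\<in>\<F>. (\<sigma> \<inter> \<tau>) face_of \<sigma> \<and> (\<sigma> \<inter> \<tau>) face_of \<tau>)"

definition complete_rational_fan :: "(real^'n) set set \<Rightarrow> bool" where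
  "complete_rational_fan \<F> \<longleftrightarrow> rational_fan \<F> \<and> \<Union>\<F> = UNIV"

definition rays :: "(real^'n) set set \<Rightarrow> (real^'n) set set" where
  "rays \<F> = {\<rho> \<in> \<F>. aff_dim \<rho> = 1}"

definition primitive :: "int^'n \<Rightarrow> bool" where
  "primitive u \<longleftrightarrow> Gcd (range (\<lambda>j. u $ j)) = 1"

text \<open>The columns of the \<open>n \<times> k\<close> matrix \<open>V\<close> are the primitive ray generators, each ray listed once;
  so \<open>CARD('k)\<close> is the number of rays. The entry \<open>V $ j $ i\<close> is the coordinate \<open>(v\<^sub>i)\<^sub>j\<close>.\<close>

definition ray_matrix :: "(real^'n) set set \<Rightarrow> int^'k^'n \<Rightarrow> bool" where
  "ray_matrix \<F> V \<longleftrightarrow>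
     bij_betw (\<lambda>i. convex_cone hull {real_vec (column i V)}) UNIV (rays \<F>) \<and>
     (\<forall>i. primitive (column i V))"

section \<open>The Cox ring and its grading\<close>

type_synonym 'k exponent = "'k \<Rightarrow>\<^sub>0 nat"
type_synonym 'k cox_ring = "'k exponent \<Rightarrow>\<^sub>0 complex"

abbreviation supp :: "'k cox_ring \<Rightarrow> 'k exponent set" where
  "supp f \<equiv> Poly_Mapping.keys f"

abbreviation cf :: "'k cox_ring \<Rightarrow> 'k exponent \<Rightarrow> complex" where
  "cf f \<equiv> Poly_Mapping.lookup f"

definition expo_int :: "'k::finite exponent \<Rightarrow> int^'k" where
  "expo_int l = (\<chi> i. int (Poly_Mapping.lookup l i))"

definition Cl_rel :: "int^'k^'n \<Rightarrow> ((int^'k) \<times> (int^'k)) set" where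
  "Cl_rel V = {(a, b). b - a \<in> range (\<lambda>m. transpose V *v m)}"

definition Cl :: "int^'k^'n \<Rightarrow> (int^'k) set set" where
  "Cl V = UNIV // Cl_rel V"

definition monomial_degree :: "int^'k^'n \<Rightarrow> 'k exponent \<Rightarrow> (int^'k) set" where
  "monomial_degree V l = Cl_rel V `` {expo_int l}"

definition homogeneous :: "int^'k^'n \<Rightarrow> (int^'k) set \<Rightarrow> 'k cox_ring \<Rightarrow> bool" where
  "homogeneous V d f \<longleftrightarrow> (\<forall>l\<in>supp f. monomial_degree V l = d)"

definition positive_coeffs :: "'k cox_ring \<Rightarrow> bool" where
  "positive_coeffs f \<longleftrightarrow> (\<forall>l\<in>supp f. cf f l \<in> \<real> \<and> 0 < Re (cf f l))"

definition newton_polytope :: "'k::finite cox_ring \<Rightarrow> (real^'k) set" where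
  "newton_polytope f = convex hull ((\<lambda>l. real_vec (expo_int l)) ` supp f)"

section \<open>Evaluation and tropicalization\<close>

definition monom_eval :: "'k::finite exponent \<Rightarrow> 'a::comm_semiring_1^'k \<Rightarrow> 'a" where
  "monom_eval l x = (\<Prod>i\<in>UNIV. x $ i ^ Poly_Mapping.lookup l i)"

definition cox_eval :: "'k::finite cox_ring \<Rightarrow> complex^'k \<Rightarrow> complex" where
  "cox_eval f x = (\<Sum>l\<in>supp f. cf f l * monom_eval l x)"

text \<open>The value at a real point, which is itself real when the coefficients are.\<close>

definition real_eval :: "'k::finite cox_ring \<Rightarrow> real^'k \<Rightarrow> real" where
  "real_eval f x = Re (cox_eval f (\<chi> i. of_real (x $ i)))"

definition trop :: "'k::finite cox_ring \<Rightarrow> real^'k \<Rightarrow> real" where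
  "trop f x = (MAX l\<in>supp f. monom_eval l x)"

section \<open>The Cox quotient and the positive part\<close>

definition cox_map :: "int^'k^'n \<Rightarrow> 'a::field^'k \<Rightarrow> 'a^'n" where
  "cox_map V x = (\<chi> j. \<Prod>i\<in>UNIV. x $ i powi (V $ j $ i))"

definition pos_orthant :: "(real^'k) set" where
  "pos_orthant = {x. \<forall>i. 0 < x $ i}"

text \<open>The positive part lies in the real points of the dense torus, whose coordinates \<open>t\<^sub>j\<close> are
  real there.\<close>

definition X_pos :: "int^'k^'n \<Rightarrow> (real^'n) set" where
  "X_pos V = cox_map V ` pos_orthant"

text \<open>A function on the positive orthant that is constant on the fibres of the Cox map, viewed as a
  function on the positive part.\<close>

definition descend :: "int^'k^'n \<Rightarrow> (real^'k \<Rightarrow> real) \<Rightarrow> real^'n \<Rightarrow> real" where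
  "descend V F t = (THE y. \<forall>x\<in>pos_orthant. cox_map V x = t \<longrightarrow> F x = y)"

section \<open>The canonical form\<close>

text \<open>The value at \<open>x\<close> of the form
  \<open>\<Omega> = \<Sum>\<^bsub>|I| = n\<^esub> det V\<^sub>I \<And>\<^bsub>i \<in> I\<^esub> dx\<^sub>i / x\<^sub>i\<close>
  on the tangent vectors \<open>u $ q\<close>, where a wedge of \<open>n\<close> covectors is evaluated on \<open>n\<close> vectors as the
  determinant of the matrix of values. Reordering \<open>I\<close> changes the sign of both determinants, so the
  choice of the enumeration \<open>b\<close> is immaterial as long as both use the same one.\<close>

definition canonical_form :: "int^'k^'n \<Rightarrow> real^'k \<Rightarrow> real^'k^'n \<Rightarrow> real" where
  "canonical_form V x u =
     (\<Sum>I | I \<subseteq> (UNIV :: 'k set) \<and> card I = CARD('n).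
        let b = (SOME b. bij_betw b (UNIV :: 'n set) I) in
        real_of_int (det (\<chi> j p. V $ j $ b p)) * det (\<chi> p q. u $ q $ b p / x $ b p))"

text \<open>The same form viewed on the positive part: the form at \<open>t\<close> whose pullback along the Cox map
  is \<open>canonical_form\<close>.\<close>

definition canonical_form_X :: "int^'k^'n \<Rightarrow> real^'n \<Rightarrow> real^'n^'n \<Rightarrow> real" where
  "canonical_form_X V t w =
     (THE c. \<forall>x\<in>pos_orthant. \<forall>u. cox_map V x = t \<and>
        (\<forall>q. frechet_derivative (cox_map V) (at x) (u $ q) = w $ q) \<longrightarrow>
        canonical_form V x u = c)"

text \<open>The measure \<open>A \<mapsto> \<integral>\<^sub>A \<Omega>\<close> on the positive part, oriented so that the form is positive: in the
  coordinates \<open>t\<^sub>j\<close> its Lebesgue density is the absolute value of the form on the coordinate frame.\<close>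

definition canonical_measure :: "int^'k^'n \<Rightarrow> (real^'n) measure" where
  "canonical_measure V =
     density (restrict_space lborel (X_pos V))
       (\<lambda>t. ennreal \<bar>canonical_form_X V t (\<chi> q. axis q 1)\<bar>)"

section \<open>Rejection sampling\<close>

definition trop_ratio :: "int^'k^'n \<Rightarrow> 'k cox_ring \<Rightarrow> 'k cox_ring \<Rightarrow> real^'n \<Rightarrow> real" where
  "trop_ratio V f g = descend V (\<lambda>x. trop f x / trop g x)"

definition trop_integral :: "int^'k^'n \<Rightarrow> 'k cox_ring \<Rightarrow> 'k cox_ring \<Rightarrow> real" where
  "trop_integral V f g = (\<integral>t. trop_ratio V f g t \<partial>canonical_measure V)"

definition trop_measure :: "int^'k^'n \<Rightarrow> 'k cox_ring \<Rightarrow> 'k cox_ring \<Rightarrow> (real^'n) measure" where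
  "trop_measure V f g =
     density (canonical_measure V) (\<lambda>t. ennreal (1 / trop_integral V f g * trop_ratio V f g t))"

definition h_fun :: "int^'k^'n \<Rightarrow> 'k cox_ring \<Rightarrow> 'k cox_ring \<Rightarrow> real^'n \<Rightarrow> real" where
  "h_fun V f g =
     descend V (\<lambda>x. real_eval f x * trop g x / (real_eval g x * trop f x))"

text \<open>The proposal \<open>t\<close> and the independent threshold \<open>\<xi>\<close>, uniform on \<open>[0, M]\<close>, are drawn jointly
  from the product measure.\<close>

definition acceptance_rate ::
    "int^'k^'n \<Rightarrow> 'k cox_ring \<Rightarrow> 'k cox_ring \<Rightarrow> real \<Rightarrow> real" where
  "acceptance_rate V f g M =
     (let P = trop_measure V f g \<Otimes>\<^sub>M uniform_measure lborel {0..M}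
      in measure P {(t, \<xi>) \<in> space P. \<xi> < h_fun V f g t})"

end

theory Submission
  imports Defs
begin

text \<open>
  Polynomials with positive coefficients are comparable to their tropicalizations: the value
  lies between the smallest coefficient and the sum of the coefficients times the tropical
  value (\<open>real_eval_lower\<close>, \<open>real_eval_upper\<close>). Dividing the bounds for \<open>f\<close> and \<open>g\<close> gives
  \<open>M1 \<le> h\<close> everywhere. Hence every proposal with \<open>\<xi> < M1\<close> is accepted, and as \<open>\<xi>\<close> is uniform on
  \<open>[0, M2]\<close> and independent of the proposal, this has probability \<open>M1 / M2\<close>
  (\<open>rejection_sampling_acceptance\<close>).

  The work lies in showing that the proposal distribution is a probability measure at all, and
  that \<open>h\<close> is a measurable function on the positive part. In logarithmic coordinates the Cox
  map is the matrix \<open>V\<close>, monomials are exponentials of linear forms, and exponents of equal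
  degree differ by the row space of \<open>V\<close>. So an \<open>n\<close>-dimensional Newton polytope forces \<open>V\<close> to have
  rank \<open>n\<close> (\<open>affine_hull_exponents\<close>); the Cox map then has a measurable section, the positive part
  is the positive orthant, and quotients of equal degree descend to measurable functions
  (\<open>homogeneous_scale_on_fibres\<close>, \<open>borel_measurable_descend\<close>). By the Cauchy--Binet formula the
  canonical form descends to the wedge of the \<open>dt\<^sub>j / t\<^sub>j\<close> (\<open>canonical_form_X_eq\<close>), so the
  canonical measure has Lebesgue density \<open>\<Prod>\<^sub>j 1 / t\<^sub>j\<close>.

  It remains to normalize: since the Newton polytope of \<open>f\<close> lies in the relative interior of that
  of \<open>g\<close>, the ratio of the tropicalizations decays like \<open>\<Prod>\<^sub>j exp (- \<delta> \<bar>ln t\<^sub>j\<bar>)\<close> for some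
  \<open>\<delta> > 0\<close> (\<open>trop_ratio_decay\<close>), which is integrable for that density. The tropical integral is
  therefore finite, and it is positive because the integrand is.
\<close>

section \<open>The Cauchy--Binet formula\<close>

text \<open>Expanding each entry of the product turns the Leibniz formula into a sum over all choices
\<open>\<phi>\<close> of one inner index per row; for a fixed \<open>\<phi>\<close> the signed sum over permutations is the determinant
of the selected rows of \<open>B\<close>.\<close>

lemma det_mult_sum_functions:
  fixes A :: "'a::comm_ring_1^'k^'n" and B :: "'a^'n^'k"
  shows "det (A ** B) = (\<Sum>\<phi>\<in>UNIV. (\<Prod>j\<in>UNIV. A $ j $ \<phi> j) * det (\<chi> j. B $ \<phi> j))"
proof -
  have PiE: "(UNIV :: 'n set) \<rightarrow>\<^sub>E (UNIV :: 'k set) = UNIV"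
    by auto
  have expand: "(\<Prod>j\<in>UNIV. (A ** B) $ j $ p j)
      = (\<Sum>\<phi>\<in>UNIV. (\<Prod>j\<in>UNIV. A $ j $ \<phi> j) * (\<Prod>j\<in>UNIV. B $ \<phi> j $ p j))" for p
    using prod_sum_PiE[of "UNIV :: 'n set" "\<lambda>_. UNIV :: 'k set" "\<lambda>j i. A $ j $ i * B $ i $ p j"]
    by (simp add: matrix_matrix_mult_def PiE prod.distrib)
  have "det (A ** B) = (\<Sum>p | p permutes (UNIV :: 'n set). \<Sum>\<phi>\<in>UNIV.
      (\<Prod>j\<in>UNIV. A $ j $ \<phi> j) * (of_int (sign p) * (\<Prod>j\<in>UNIV. B $ \<phi> j $ p j)))"
    unfolding det_def expand by (simp add: sum_distrib_left mult_ac)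
  also have "\<dots> = (\<Sum>\<phi>\<in>UNIV. (\<Prod>j\<in>UNIV. A $ j $ \<phi> j) * det (\<chi> j. B $ \<phi> j))"
    by (subst sum.swap) (simp add: det_def sum_distrib_left)
  finally show ?thesis .
qed

text \<open>In the sum over \<open>\<phi>\<close> only injections survive, and those with a given range \<open>I\<close> are the
rearrangements of one enumeration of \<open>I\<close>.\<close>

lemma bij_betw_permutes_injections:
  fixes b :: "'n::finite \<Rightarrow> 'k"
  assumes b: "bij_betw b UNIV I"
  shows "bij_betw (\<lambda>p. b \<circ> p) {p. p permutes UNIV} {\<phi>. inj \<phi> \<and> range \<phi> = I}"
proof (rule bij_betwI[where g = "\<lambda>\<phi>. inv b \<circ> \<phi>"])
  have inj: "inj b" and ran: "range b = I"
    using b by (auto simp: bij_betw_def)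
  show "(\<lambda>p. b \<circ> p) \<in> {p. p permutes UNIV} \<rightarrow> {\<phi>. inj \<phi> \<and> range \<phi> = I}"
  proof clarify
    fix p :: "'n \<Rightarrow> 'n"
    assume p: "p permutes UNIV"
    then show "inj (b \<circ> p) \<and> range (b \<circ> p) = I"
      using inj ran permutes_inj[OF p] permutes_surj[OF p] by (metis inj_compose image_comp)
  qed
  show "(\<lambda>\<phi>. inv b \<circ> \<phi>) \<in> {\<phi>. inj \<phi> \<and> range \<phi> = I} \<rightarrow> {p. p permutes UNIV}"
  proof clarify
    fix \<phi> :: "'n \<Rightarrow> 'k"
    assume \<phi>: "inj \<phi>" "I = range \<phi>"
    have "inj (inv b \<circ> \<phi>)"
      using \<phi> ran by (intro comp_inj_on inj_on_inv_into) auto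
    then have "bij (inv b \<circ> \<phi>)"
      unfolding bij_def using finite_UNIV_inj_surj[OF finite] by blast
    then show "inv b \<circ> \<phi> permutes UNIV"
      by (auto intro: bij_imp_permutes)
  qed
  show "inv b \<circ> (b \<circ> p) = p" for p
    using inj by (simp add: o_assoc)
  show "b \<circ> (inv b \<circ> \<phi>) = \<phi>" if "\<phi> \<in> {\<phi>. inj \<phi> \<and> range \<phi> = I}" for \<phi>
    using that ran by (auto simp: fun_eq_iff intro!: f_inv_into_f)
qed

text \<open>The enumeration \<open>b I\<close> is arbitrary because changing it multiplies both minors by the same sign;
this is also why the choice operator in the definition of the canonical form is harmless.\<close>

theorem Cauchy_Binet:
  fixes A :: "'a::comm_ring_1^'k^'n" and B :: "'a^'n^'k"
  assumes b: "\<And>I. card I = CARD('n) \<Longrightarrow> bij_betw (b I) (UNIV :: 'n set) I"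
  shows "det (A ** B) = (\<Sum>I | I \<subseteq> (UNIV :: 'k set) \<and> card I = CARD('n).
           det (\<chi> j p. A $ j $ b I p) * det (\<chi> p. B $ b I p))"
proof -
  let ?T = "\<lambda>\<phi>. (\<Prod>j\<in>UNIV. A $ j $ \<phi> j) * det (\<chi> j. B $ \<phi> j)"
  let ?K = "{I. I \<subseteq> (UNIV :: 'k set) \<and> card I = CARD('n)}"
  have zero: "?T \<phi> = 0" if not_inj: "\<not> inj \<phi>" for \<phi> :: "'n \<Rightarrow> 'k"
  proof -
    obtain i j where "i \<noteq> j" "\<phi> i = \<phi> j"
      using not_inj by (auto simp: inj_on_def)
    then have "det (\<chi> j. B $ \<phi> j) = 0"
      by (intro det_identical_rows[of i j]) (auto simp: row_def)
    then show ?thesis by simp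
  qed
  have fibre: "(\<Sum>\<phi> | \<phi> \<in> {\<phi>. inj \<phi>} \<and> range \<phi> = I. ?T \<phi>)
      = det (\<chi> j p. A $ j $ b I p) * det (\<chi> p. B $ b I p)" if I: "I \<in> ?K" for I
  proof -
    have bI: "bij_betw (b I) UNIV I"
      using b I by blast
    have "(\<Sum>\<phi> | \<phi> \<in> {\<phi>. inj \<phi>} \<and> range \<phi> = I. ?T \<phi>)
        = (\<Sum>p | p permutes UNIV. ?T (b I \<circ> p))"
      using sum.reindex_bij_betw[OF bij_betw_permutes_injections[OF bI], of ?T] by simp
    also have "\<dots> = (\<Sum>p | p permutes UNIV.
        of_int (sign p) * (\<Prod>j\<in>UNIV. A $ j $ b I (p j)) * det (\<chi> p. B $ b I p))"
    proof (rule sum.cong[OF refl])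
      fix p :: "'n \<Rightarrow> 'n"
      assume "p \<in> {p. p permutes UNIV}"
      then show "?T (b I \<circ> p)
          = of_int (sign p) * (\<Prod>j\<in>UNIV. A $ j $ b I (p j)) * det (\<chi> p. B $ b I p)"
        using det_permute_rows[of p "\<chi> p. B $ b I p"] by simp
    qed
    finally show ?thesis
      by (simp add: det_def sum_distrib_right)
  qed
  have "det (A ** B) = (\<Sum>\<phi> | inj \<phi>. ?T \<phi>)"
    unfolding det_mult_sum_functions using zero by (intro sum.mono_neutral_right) auto
  also have "\<dots> = (\<Sum>I\<in>?K. \<Sum>\<phi> | \<phi> \<in> {\<phi>. inj \<phi>} \<and> range \<phi> = I. ?T \<phi>)"
    by (rule sum.group[symmetric]) (auto simp: card_image)
  finally show ?thesis
    using fibre by simp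
qed

section \<open>The canonical form as a determinant\<close>

definition real_mat :: "int^'k^'n \<Rightarrow> real^'k^'n" where
  "real_mat V = (\<chi> j i. real_of_int (V $ j $ i))"

lemma real_of_int_det: "real_of_int (det A) = det (real_mat A)"
  by (simp add: det_def real_mat_def)

text \<open>By Cauchy--Binet, the sum over \<open>n\<close>-subsets is the determinant of \<open>V\<close> times the matrix of
logarithmic derivatives \<open>dx\<^sub>i / x\<^sub>i\<close> of the tangent vectors, that is, the wedge of the forms
\<open>dt\<^sub>j / t\<^sub>j\<close> pulled back along the Cox map.\<close>

lemma canonical_form_eq_det:
  "canonical_form V x u = det (real_mat V ** (\<chi> i q. u $ q $ i / x $ i))"
proof -
  define b where "b I = (SOME b. bij_betw b (UNIV :: 'b set) I)" for I :: "'a set"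
  have b: "bij_betw (b I) UNIV I" if "card I = CARD('b)" for I
  proof -
    have "finite I" using that by simp
    then have "\<exists>f. bij_betw f (UNIV :: 'b set) I"
      using that by (intro finite_same_card_bij) auto
    then show ?thesis unfolding b_def by (rule someI_ex)
  qed
  have entry: "(\<chi> i q. u $ q $ i / x $ i) $ b I p = (\<chi> q. u $ q $ b I p / x $ b I p)" for I p
    by simp
  show ?thesis
    unfolding canonical_form_def Let_def b_def[symmetric] real_of_int_det
    by (subst Cauchy_Binet[where b = b]) (simp_all only: b entry, simp add: real_mat_def)
qed

section \<open>Logarithmic coordinates\<close>

definition log_vec :: "real^'m \<Rightarrow> real^'m" where
  "log_vec x = (\<chi> i. ln (x $ i))"

definition exp_vec :: "real^'m \<Rightarrow> real^'m" where
  "exp_vec y = (\<chi> i. exp (y $ i))"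

lemma exp_vec_pos [simp]: "exp_vec y \<in> pos_orthant"
  by (simp add: exp_vec_def pos_orthant_def)

lemma log_exp_vec [simp]: "log_vec (exp_vec y) = y"
  by (simp add: exp_vec_def log_vec_def)

lemma exp_log_vec [simp]: "x \<in> pos_orthant \<Longrightarrow> exp_vec (log_vec x) = x"
  by (simp add: exp_vec_def log_vec_def pos_orthant_def vec_eq_iff)

text \<open>In logarithmic coordinates monomials become linear forms and the Cox map becomes the matrix \<open>V\<close>;
all later statements about the positive part are linear algebra in these coordinates.\<close>

lemma monom_eval_exp:
  fixes x :: "real^'k"
  assumes "x \<in> pos_orthant"
  shows "monom_eval l x = exp (real_vec (expo_int l) \<bullet> log_vec x)"
proof -
  have "x $ i ^ Poly_Mapping.lookup l i = exp (real (Poly_Mapping.lookup l i) * ln (x $ i))" for i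
    using assms by (simp add: pos_orthant_def exp_of_nat_mult)
  then show ?thesis
    by (simp add: monom_eval_def inner_vec_def real_vec_def expo_int_def log_vec_def exp_sum)
qed

lemma monom_eval_pos: "x \<in> pos_orthant \<Longrightarrow> 0 < (monom_eval l x :: real)"
  by (simp add: monom_eval_exp)

lemma cox_map_exp:
  fixes x :: "real^'k"
  assumes "x \<in> pos_orthant"
  shows "cox_map V x = exp_vec (real_mat V *v log_vec x)"
proof -
  have "x $ i powi e = exp (real_of_int e * ln (x $ i))" for i e
    using assms exp_power_int[of "ln (x $ i)" e] by (simp add: pos_orthant_def)
  then show ?thesis
    by (simp add: cox_map_def exp_vec_def matrix_vector_mult_def real_mat_def log_vec_def exp_sum)
qed

lemma cox_map_pos: "x \<in> pos_orthant \<Longrightarrow> cox_map V x \<in> pos_orthant"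
  for x :: "real^'k"
  by (simp add: cox_map_exp)

lemma log_cox_map:
  fixes x :: "real^'k"
  shows "x \<in> pos_orthant \<Longrightarrow> log_vec (cox_map V x) = real_mat V *v log_vec x"
  by (simp add: cox_map_exp)

lemma open_pos_orthant: "open (pos_orthant :: (real^'m) set)"
  unfolding pos_orthant_def Collect_all_eq
  by (intro open_INT) (auto intro!: open_Collect_less continuous_intros)

text \<open>The logarithmic derivative of the Cox map is again \<open>V\<close>, which is the chain rule for the
exponential formula; that formula is valid on an open neighbourhood of \<open>x\<close>.\<close>

lemma has_derivative_cox_map:
  fixes x :: "real^'k" and V :: "int^'k^'n"
  assumes x: "x \<in> pos_orthant"
  shows "(cox_map V has_derivative
           (\<lambda>u. \<chi> j. cox_map V x $ j * (real_mat V *v (\<chi> i. u $ i / x $ i)) $ j)) (at x)"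
proof -
  have comp: "((\<lambda>y. exp_vec (real_mat V *v log_vec y) $ j) has_derivative
      (\<lambda>u. cox_map V x $ j * (real_mat V *v (\<chi> i. u $ i / x $ i)) $ j)) (at x)" for j
    unfolding cox_map_exp[OF x] exp_vec_def log_vec_def matrix_vector_mult_def vec_lambda_beta
    using x
    by (auto intro!: derivative_eq_intros bounded_linear.has_derivative[OF bounded_linear_vec_nth]
        simp: pos_orthant_def field_simps)
  have "((\<lambda>y. exp_vec (real_mat V *v log_vec y)) has_derivative
      (\<lambda>u. \<chi> j. cox_map V x $ j * (real_mat V *v (\<chi> i. u $ i / x $ i)) $ j)) (at x)"
    using comp
    by (subst has_derivative_componentwise_within) (auto simp: Basis_vec_def inner_axis)
  then show ?thesis
    by (rule has_derivative_transform_within_open[OF _ open_pos_orthant x])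
       (simp add: cox_map_exp)
qed

section \<open>Descent to the positive part\<close>

text \<open>A right inverse \<open>W\<close> of \<open>V\<close> gives a monomial section of the Cox map. It makes the positive part
the whole positive orthant, provides the witnesses for descending functions and forms, and
is measurable, so that descended functions inherit measurability.\<close>

lemma cox_map_section:
  assumes W: "real_mat V ** W = mat 1" and t: "t \<in> pos_orthant"
  shows "cox_map V (exp_vec (W *v log_vec t)) = t"
  using t by (simp add: cox_map_exp matrix_vector_mul_assoc W)

lemma X_pos_eq_pos_orthant:
  assumes W: "real_mat V ** W = mat 1"
  shows "X_pos V = pos_orthant"
proof
  show "X_pos V \<subseteq> pos_orthant"
    by (auto simp: X_pos_def cox_map_pos)
  show "pos_orthant \<subseteq> X_pos V"
    using cox_map_section[OF W] unfolding X_pos_def by (metis exp_vec_pos image_eqI subsetI)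
qed

lemma descend_cox_map:
  assumes "\<And>x y. x \<in> pos_orthant \<Longrightarrow> y \<in> pos_orthant \<Longrightarrow> cox_map V x = cox_map V y \<Longrightarrow> F x = F y"
    and "x \<in> pos_orthant"
  shows "descend V F (cox_map V x) = F x"
  unfolding descend_def
proof (rule the_equality)
  show "\<forall>y\<in>pos_orthant. cox_map V y = cox_map V x \<longrightarrow> F y = F x"
    using assms by blast
  show "c = F x" if "\<forall>y\<in>pos_orthant. cox_map V y = cox_map V x \<longrightarrow> F y = c" for c
    using that assms(2) by blast
qed

text \<open>Every lift of a tangent frame \<open>w\<close> at \<open>t\<close> has logarithmic derivatives that \<open>V\<close> sends to
\<open>w / t\<close>, so the determinant formula gives the same value on all lifts; the section supplies a
lift. The form on the positive part is therefore the wedge of the \<open>dt\<^sub>j / t\<^sub>j\<close>.\<close>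

lemma canonical_form_X_eq:
  fixes V :: "int^'k^'n" and w :: "real^'n^'n"
  assumes W: "real_mat V ** W = mat 1" and t: "t \<in> pos_orthant"
  shows "canonical_form_X V t w = det (\<chi> j q. w $ q $ j / t $ j)"
proof -
  have tpos: "t $ j > 0" for j
    using t by (simp add: pos_orthant_def)
  have deriv: "frechet_derivative (cox_map V) (at x) v
      = (\<chi> j. t $ j * (real_mat V *v (\<chi> i. v $ i / x $ i)) $ j)"
    if "x \<in> pos_orthant" "cox_map V x = t" for x v
    unfolding frechet_derivative_at[OF has_derivative_cox_map[OF that(1)], symmetric] that(2)
    by (rule refl)
  have entry: "(real_mat V ** (\<chi> i q. u $ q $ i / x $ i)) $ j $ q
      = (real_mat V *v (\<chi> i. u $ q $ i / x $ i)) $ j" for u :: "real^'k^'n" and x j q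
    by (simp add: matrix_matrix_mult_def matrix_vector_mult_def)
  have unique: "canonical_form V x u = det (\<chi> j q. w $ q $ j / t $ j)"
    if x: "x \<in> pos_orthant" "cox_map V x = t"
      and u: "\<And>q. frechet_derivative (cox_map V) (at x) (u $ q) = w $ q" for x u
  proof -
    have "(real_mat V *v (\<chi> i. u $ q $ i / x $ i)) $ j = w $ q $ j / t $ j" for j q
      using u[of q] tpos[of j] unfolding deriv[OF x] by (auto simp: vec_eq_iff field_simps)
    then have "real_mat V ** (\<chi> i q. u $ q $ i / x $ i) = (\<chi> j q. w $ q $ j / t $ j)"
      by (simp add: vec_eq_iff entry)
    then show ?thesis
      by (simp add: canonical_form_eq_det)
  qed
  define x where "x = exp_vec (W *v log_vec t)"
  \<comment> \<open>the lift of the frame w: W is applied to the logarithmic derivatives w / t\<close>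
  define u where "u = (\<chi> q i. x $ i * (W *v (\<chi> j. w $ q $ j / t $ j)) $ i)"
  have x: "x \<in> pos_orthant" "cox_map V x = t"
    using cox_map_section[OF W t] by (simp_all add: x_def)
  have "(\<chi> i. u $ q $ i / x $ i) = W *v (\<chi> j. w $ q $ j / t $ j)" for q
    using x(1) by (simp add: u_def pos_orthant_def vec_eq_iff order_less_imp_not_eq2)
  then have u: "frechet_derivative (cox_map V) (at x) (u $ q) = w $ q" for q
    unfolding deriv[OF x] using tpos
    by (simp add: matrix_vector_mul_assoc W vec_eq_iff order_less_imp_not_eq2)
  show ?thesis
    unfolding canonical_form_X_def
  proof (rule the_equality)
    show "\<forall>x\<in>pos_orthant. \<forall>u. cox_map V x = t \<and>
        (\<forall>q. frechet_derivative (cox_map V) (at x) (u $ q) = w $ q) \<longrightarrow>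
        canonical_form V x u = det (\<chi> j q. w $ q $ j / t $ j)"
      using unique by blast
    show "c = det (\<chi> j q. w $ q $ j / t $ j)"
      if c: "\<forall>x\<in>pos_orthant. \<forall>u. cox_map V x = t \<and>
        (\<forall>q. frechet_derivative (cox_map V) (at x) (u $ q) = w $ q) \<longrightarrow>
        canonical_form V x u = c" for c
    proof -
      have "canonical_form V x u = c"
        using c[rule_format, OF x(1)] x(2) u by blast
      then show ?thesis using unique[OF x u] by simp
    qed
  qed
qed

lemma canonical_form_X_frame:
  assumes W: "real_mat V ** W = mat 1" and t: "t \<in> pos_orthant"
  shows "\<bar>canonical_form_X V t (\<chi> q. axis q 1)\<bar> = (\<Prod>j\<in>UNIV. inverse (t $ j))"
proof -
  have "canonical_form_X V t (\<chi> q. axis q 1) = (\<Prod>j\<in>UNIV. inverse (t $ j))"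
    unfolding canonical_form_X_eq[OF W t]
    by (subst det_diagonal) (simp_all add: axis_def inverse_eq_divide)
  moreover have "0 \<le> (\<Prod>j\<in>UNIV. inverse (t $ j))"
    using t by (intro prod_nonneg) (simp add: pos_orthant_def order_less_imp_le)
  ultimately show ?thesis by simp
qed

section \<open>Homogeneity and the fibres of the Cox map\<close>

lemma real_vec_transpose_mult: "real_vec (transpose V *v m) = real_vec m v* real_mat V"
  by (simp add: real_vec_def real_mat_def matrix_vector_mult_def vector_matrix_mult_def
      Finite_Cartesian_Product.transpose_def vec_eq_iff) (intro allI sum.cong refl mult.commute)

lemma real_vec_diff: "real_vec (a - b) = real_vec a - real_vec b"
  by (simp add: real_vec_def vec_eq_iff)

lemma monomial_degree_eqD:
  assumes "monomial_degree V l = monomial_degree V l'"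
  obtains m where "real_vec (expo_int l') - real_vec (expo_int l) = real_vec m v* real_mat V"
proof -
  have "transpose V *v 0 = 0"
    by (simp add: matrix_vector_mult_def vec_eq_iff)
  then have "expo_int l' - expo_int l' \<in> range (\<lambda>m. transpose V *v m)"
    by (metis diff_self rangeI)
  then have "expo_int l' \<in> monomial_degree V l'"
    by (simp add: monomial_degree_def Cl_rel_def)
  then have "expo_int l' \<in> monomial_degree V l"
    using assms by simp
  then obtain m where "expo_int l' - expo_int l = transpose V *v m"
    unfolding monomial_degree_def Cl_rel_def by blast
  then have "real_vec (expo_int l') - real_vec (expo_int l) = real_vec m v* real_mat V"
    unfolding real_vec_transpose_mult[symmetric] by (metis real_vec_diff)
  then show ?thesis by (rule that)
qed

text \<open>Two points of a fibre differ in logarithmic coordinates by a vector of the kernel of \<open>V\<close>, and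
exponents of equal degree differ by a vector of the row space of \<open>V\<close>, which is orthogonal to
that kernel. Hence the scaling factor of a monomial depends on its degree only.\<close>

lemma monomials_scale_on_fibres:
  fixes x y :: "real^'k" and V :: "int^'k^'n"
  assumes x: "x \<in> pos_orthant" and y: "y \<in> pos_orthant" and xy: "cox_map V x = cox_map V y"
  obtains c where "c > 0" "\<And>l. monomial_degree V l = d \<Longrightarrow> monom_eval l x = c * monom_eval l y"
proof (cases "\<exists>l0. monomial_degree V l0 = d")
  case True
  then obtain l0 where l0: "monomial_degree V l0 = d" ..
  let ?e = "\<lambda>l. real_vec (expo_int l)" and ?\<Delta> = "log_vec x - log_vec y"
  have ker: "real_mat V *v ?\<Delta> = 0"
    using log_cox_map[OF x, of V] log_cox_map[OF y, of V] xy
    by (simp add: matrix_vector_mult_diff_distrib)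
  show ?thesis
  proof (rule that[of "exp (?e l0 \<bullet> ?\<Delta>)"])
    fix l
    assume "monomial_degree V l = d"
    then obtain m where m: "?e l - ?e l0 = real_vec m v* real_mat V"
      using monomial_degree_eqD[of V l0 l] l0 by auto
    have "(?e l - ?e l0) \<bullet> ?\<Delta> = 0"
      unfolding m dot_lmul_matrix ker by simp
    then have "?e l \<bullet> log_vec x = ?e l0 \<bullet> ?\<Delta> + ?e l \<bullet> log_vec y"
      by (simp add: inner_diff_left inner_diff_right)
    then show "monom_eval l x = exp (?e l0 \<bullet> ?\<Delta>) * monom_eval l y"
      by (simp add: monom_eval_exp x y exp_add[symmetric])
  qed simp
qed (use that[of 1] in auto)

lemma real_eval_eq: "real_eval f x = (\<Sum>l\<in>supp f. Re (cf f l) * monom_eval l x)"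
proof -
  have "monom_eval l (\<chi> i. of_real (x $ i)) = complex_of_real (monom_eval l x)" for l
    by (simp add: monom_eval_def)
  then show ?thesis
    by (simp add: real_eval_def cox_eval_def)
qed

text \<open>The common factor \<open>c\<close> is chosen before \<open>f\<close>, so it cancels in every quotient of two
homogeneous polynomials, or tropical polynomials, of degree \<open>d\<close>.\<close>

lemma homogeneous_scale_on_fibres:
  fixes x y :: "real^'k" and V :: "int^'k^'n"
  assumes x: "x \<in> pos_orthant" and y: "y \<in> pos_orthant" and xy: "cox_map V x = cox_map V y"
  obtains c where "c > 0"
    "\<And>f. homogeneous V d f \<Longrightarrow> real_eval f x = c * real_eval f y"
    "\<And>f. homogeneous V d f \<Longrightarrow> f \<noteq> 0 \<Longrightarrow> trop f x = c * trop f y"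
proof -
  obtain c where c: "c > 0" "\<And>l. monomial_degree V l = d \<Longrightarrow> monom_eval l x = c * monom_eval l y"
    using monomials_scale_on_fibres[OF x y xy] by blast
  show ?thesis
  proof (rule that[OF c(1)])
    fix f
    assume f: "homogeneous V d f"
    then have mono: "monom_eval l x = c * monom_eval l y" if "l \<in> supp f" for l
      using c(2) that by (auto simp: homogeneous_def)
    show "real_eval f x = c * real_eval f y"
      unfolding real_eval_eq sum_distrib_left by (intro sum.cong) (auto simp: mono)
    assume "f \<noteq> 0"
    have "c * trop f y = Max ((\<lambda>a. c * a) ` (\<lambda>l. monom_eval l y) ` supp f)"
      unfolding trop_def using c(1) \<open>f \<noteq> 0\<close>
      by (intro mono_Max_commute monoI) auto
    also have "\<dots> = trop f x"
      unfolding trop_def image_image by (intro arg_cong[of _ _ Max] image_cong) (auto simp: mono)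
    finally show "trop f x = c * trop f y" ..
  qed
qed

section \<open>Newton polytopes and the decay of the tropical ratio\<close>

lemma subspace_row_space: "subspace (range (\<lambda>v. v v* (M :: real^'k^'n)))"
  using linear_subspace_image[OF matrix_vector_mul_linear[of "transpose M"] subspace_UNIV] by simp

text \<open>The exponents of a homogeneous polynomial lie in one translate of the row space of \<open>V\<close>, whose
dimension is at most \<open>n\<close>. An \<open>n\<close>-dimensional Newton polytope forces equality: \<open>V\<close> has full rank
and the polytope spans the translate.\<close>

lemma affine_hull_exponents:
  fixes V :: "int^'k^'n"
  assumes g: "homogeneous V d g" "l0 \<in> supp g"
    and dim: "aff_dim (newton_polytope g) = int CARD('n)"
  defines "a0 \<equiv> real_vec (expo_int l0)"
  shows "surj ((*v) (real_mat V))"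
    and "affine hull (newton_polytope g) = (+) a0 ` range (\<lambda>v. v v* real_mat V)"
proof -
  let ?M = "real_mat V" and ?P = "(\<lambda>l. real_vec (expo_int l)) ` supp g"
  let ?R = "range (\<lambda>v. v v* ?M)"
  define S where "S = affine hull ?P"
  have S: "affine hull (newton_polytope g) = S"
    by (simp add: newton_polytope_def S_def)
  have a0: "a0 \<in> S"
    unfolding S_def a0_def using g(2) by (intro hull_inc) auto
  have P: "?P \<subseteq> (+) a0 ` ?R"
  proof clarify
    fix l
    assume "l \<in> supp g"
    then have "monomial_degree V l0 = monomial_degree V l"
      using g by (auto simp: homogeneous_def)
    then obtain m where "real_vec (expo_int l) - a0 = real_vec m v* ?M"
      unfolding a0_def by (rule monomial_degree_eqD)
    then have "real_vec (expo_int l) = a0 + real_vec m v* ?M"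
      by (simp add: algebra_simps)
    then show "real_vec (expo_int l) \<in> (+) a0 ` ?R" by blast
  qed
  have sub: "S \<subseteq> (+) a0 ` ?R"
    unfolding S_def using P
    by (intro hull_minimal affine_translation[THEN iffD1] subspace_imp_affine subspace_row_space)
  let ?U = "(\<lambda>x. x - a0) ` S"
  have "subspace ?U"
    using affine_diffs_subspace_subtract[OF _ a0] by (simp add: S_def)
  moreover have "?U \<subseteq> ?R"
    using sub by auto
  moreover have dimR: "dim ?R = rank ?M"
    using rank_dim_range[of "transpose ?M"] by (simp add: rank_transpose)
  moreover have dimU: "dim ?U = CARD('n)"
    using aff_dim_dim_affine_diffs[OF _ a0] dim S by (metis S_def aff_dim_affine_hull affine_affine_hull of_nat_eq_iff)
  moreover have bound: "rank ?M \<le> CARD('n)"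
    using rank_bound[of ?M] by simp
  ultimately have U: "?U = ?R"
    using subspace_row_space[of ?M] by (intro subspace_dim_equal) auto
  then show "surj ((*v) ?M)"
    using dimR dimU by (simp add: full_rank_surjective[symmetric])
  have "S = (+) a0 ` ?U"
    by (simp add: image_image)
  then show "affine hull (newton_polytope g) = (+) a0 ` ?R"
    using S U by simp
qed

lemma uniform_rel_interior_radius:
  assumes "finite P" "P \<subseteq> rel_interior N"
  obtains e where "e > 0" "\<forall>a\<in>P. ball a e \<inter> affine hull N \<subseteq> N"
proof -
  have "\<exists>e>0. \<forall>a\<in>P. ball a e \<inter> affine hull N \<subseteq> N"
    using assms
  proof induction
    case (insert a P)
    then obtain e1 where e1: "e1 > 0" "\<forall>a\<in>P. ball a e1 \<inter> affine hull N \<subseteq> N"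
      by auto
    obtain e2 where e2: "e2 > 0" "ball a e2 \<inter> affine hull N \<subseteq> N"
      using insert.prems by (auto simp: mem_rel_interior_ball)
    have "ball b (min e1 e2) \<inter> affine hull N \<subseteq> N" if "b \<in> insert a P" for b
    proof -
      have "ball b (min e1 e2) \<subseteq> ball b e1" "ball b (min e1 e2) \<subseteq> ball b e2"
        by auto
      then show ?thesis
        using that e1(2) e2(2) by blast
    qed
    then show ?case
      using e1(1) e2(1) by (intro exI[of _ "min e1 e2"]) auto
  qed (auto intro: exI[of _ 1])
  then show ?thesis using that by blast
qed

lemma monom_le_trop: "l \<in> supp f \<Longrightarrow> monom_eval l x \<le> trop f x"
  by (simp add: trop_def)

lemma trop_attained:
  assumes "f \<noteq> 0"
  obtains l where "l \<in> supp f" "trop f x = monom_eval l x"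
proof -
  have "trop f x \<in> (\<lambda>l. monom_eval l x) ` supp f"
    unfolding trop_def using assms by (intro Max_in) auto
  then show ?thesis using that by blast
qed

lemma trop_pos: "f \<noteq> 0 \<Longrightarrow> x \<in> pos_orthant \<Longrightarrow> 0 < trop f x"
  by (metis trop_attained monom_eval_pos)

text \<open>A linear form on a polytope is bounded by its maximum over the vertices, and in logarithmic
coordinates that maximum is the logarithm of the tropical polynomial.\<close>

lemma newton_polytope_le_trop:
  assumes x: "x \<in> pos_orthant" and a: "a \<in> newton_polytope g"
  shows "exp (a \<bullet> log_vec x) \<le> trop g x"
proof -
  have g: "g \<noteq> 0"
    using a by (auto simp: newton_polytope_def)
  have "newton_polytope g \<subseteq> {z. log_vec x \<bullet> z \<le> ln (trop g x)}"
    unfolding newton_polytope_def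
  proof (rule hull_minimal[where S = convex, OF _ convex_halfspace_le], clarify)
    fix l
    assume "l \<in> supp g"
    then have "exp (real_vec (expo_int l) \<bullet> log_vec x) \<le> trop g x"
      using monom_le_trop[of l g x] by (simp add: monom_eval_exp x)
    then show "log_vec x \<bullet> real_vec (expo_int l) \<le> ln (trop g x)"
      using trop_pos[OF g x] by (simp add: ln_ge_iff inner_commute)
  qed
  then have "log_vec x \<bullet> a \<le> ln (trop g x)"
    using a by blast
  then show ?thesis
    using trop_pos[OF g x] by (simp add: ln_ge_iff inner_commute)
qed

text \<open>Each exponent \<open>a\<close> of \<open>f\<close> can be moved a fixed small distance in the row space without leaving the
Newton polytope of \<open>g\<close>. Moving it by \<open>\<delta>\<close> times the combination of the rows of \<open>V\<close> with
coefficients \<open>sgn (ln t\<^sub>j)\<close> increases its value at \<open>log x\<close> by \<open>\<delta> \<Sum>\<^sub>j \<bar>ln t\<^sub>j\<bar>\<close>, and the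
result is still below the logarithm of the tropicalization of \<open>g\<close>.\<close>

proposition trop_ratio_decay:
  fixes V :: "int^'k^'n" and f g :: "'k cox_ring"
  assumes g: "homogeneous V d g" "g \<noteq> 0" and f: "f \<noteq> 0"
    and dim: "aff_dim (newton_polytope g) = int CARD('n)"
    and int: "newton_polytope f \<subseteq> rel_interior (newton_polytope g)"
  obtains \<delta> where "\<delta> > 0"
    "\<And>x. x \<in> pos_orthant \<Longrightarrow>
       trop f x / trop g x \<le> (\<Prod>j\<in>UNIV. exp (- \<delta> * \<bar>ln (cox_map V x $ j)\<bar>))"
proof -
  let ?M = "real_mat V" and ?N = "newton_polytope g"
  let ?e = "\<lambda>l. real_vec (expo_int l)"
  obtain l0 where l0: "l0 \<in> supp g"
    using g(2) by (metis keys_eq_empty all_not_in_conv)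
  note hull = affine_hull_exponents(2)[OF g(1) l0 dim]
  have shift: "a + v v* ?M \<in> affine hull ?N" if a: "a \<in> affine hull ?N" for a v
  proof -
    obtain w where "a = ?e l0 + w v* ?M"
      using a unfolding hull by auto
    then have "a + v v* ?M = ?e l0 + (w + v) v* ?M"
      by (simp add: vector_matrix_left_distrib)
    then show ?thesis unfolding hull by blast
  qed
  have P: "?e ` supp f \<subseteq> rel_interior ?N"
    using int hull_subset[of "?e ` supp f" convex] by (auto simp: newton_polytope_def)
  obtain e where e: "e > 0" "\<forall>a\<in>?e ` supp f. ball a e \<inter> affine hull ?N \<subseteq> ?N"
    by (rule uniform_rel_interior_radius[OF finite_imageI[OF finite_keys] P])
  obtain K where K: "K > 0" "\<And>s. norm (s v* ?M) \<le> norm s * K"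
    using bounded_linear.pos_bounded[OF matrix_vector_mul_bounded_linear[of "transpose ?M"]] by auto
  define C where "C = real CARD('n) * K"
  \<comment> \<open>the summand 1 makes the displacement strictly smaller than the radius e, even if C = 0\<close>
  define \<delta> where "\<delta> = e / (C + 1)"
  have "C \<ge> 0"
    using K by (simp add: C_def)
  then have \<delta>: "\<delta> > 0" "\<delta> * C < e"
    using e by (simp_all add: \<delta>_def field_simps)
  have bound: "monom_eval l x \<le> trop g x * exp (- \<delta> * (\<Sum>j\<in>UNIV. \<bar>ln (cox_map V x $ j)\<bar>))"
    if l: "l \<in> supp f" and x: "x \<in> pos_orthant" for l x
  proof -
    define y where "y = log_vec (cox_map V x)"
    \<comment> \<open>among vectors with entries in [-1, 1], s maximizes the pairing with y\<close>
    define s :: "real^'n" where "s = (\<chi> j. sgn (y $ j))"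
    have "norm s \<le> real CARD('n)"
      using order_trans[OF norm_le_l1_cart[of s] sum_mono[of UNIV "\<lambda>j. \<bar>s $ j\<bar>" "\<lambda>_. 1"]]
      by (simp add: s_def abs_sgn_eq)
    then have "norm (s v* ?M) \<le> C"
      using K order_trans[OF K(2)[of s]] by (simp add: C_def mult_right_mono)
    then have "norm (\<delta> *\<^sub>R (s v* ?M)) < e"
      using \<delta> by (simp add: le_less_trans[OF mult_left_mono])
    moreover have "?e l + (\<delta> *\<^sub>R s) v* ?M \<in> affine hull ?N"
      using P l rel_interior_subset hull_subset[of ?N affine] by (intro shift) blast
    moreover have "(\<delta> *\<^sub>R s) v* ?M = \<delta> *\<^sub>R (s v* ?M)"
      by (simp add: vector_matrix_mult_def vec_eq_iff sum_distrib_left mult_ac)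
    ultimately have "?e l + \<delta> *\<^sub>R (s v* ?M) \<in> ?N"
      using bspec[OF e(2) imageI[OF l]] by (auto simp: dist_norm subset_iff)
    then have "exp ((?e l + \<delta> *\<^sub>R (s v* ?M)) \<bullet> log_vec x) \<le> trop g x"
      by (rule newton_polytope_le_trop[OF x])
    moreover have "(s v* ?M) \<bullet> log_vec x = (\<Sum>j\<in>UNIV. \<bar>ln (cox_map V x $ j)\<bar>)"
      unfolding dot_lmul_matrix log_cox_map[OF x, symmetric] y_def[symmetric]
      by (simp add: inner_vec_def s_def) (simp add: y_def log_vec_def abs_sgn mult.commute)
    ultimately show ?thesis
      by (simp add: monom_eval_exp[OF x] inner_add_left exp_add exp_minus field_simps)
  qed
  show ?thesis
  proof (rule that[OF \<delta>(1)])
    fix x :: "real^'k"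
    assume x: "x \<in> pos_orthant"
    obtain l where "l \<in> supp f" "trop f x = monom_eval l x"
      using trop_attained[OF f] by blast
    then have "trop f x / trop g x \<le> exp (- \<delta> * (\<Sum>j\<in>UNIV. \<bar>ln (cox_map V x $ j)\<bar>))"
      using bound[OF _ x] trop_pos[OF g(2) x] by (simp add: field_simps)
    then show "trop f x / trop g x \<le> (\<Prod>j\<in>UNIV. exp (- \<delta> * \<bar>ln (cox_map V x $ j)\<bar>))"
      by (simp add: exp_sum sum_distrib_left)
  qed
qed

section \<open>Integration against the canonical measure\<close>

text \<open>The integrand is \<open>s powr (\<delta> - 1)\<close> up to \<open>1\<close> and \<open>s powr (- \<delta> - 1)\<close> from \<open>1\<close> on.\<close>

lemma nn_integral_decay_finite:
  fixes \<delta> :: real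
  assumes "\<delta> > 0"
  shows "(\<integral>\<^sup>+s. ennreal (if s > 0 then inverse s * exp (- \<delta> * \<bar>ln s\<bar>) else 0) \<partial>lborel) < \<infinity>"
proof -
  let ?A = "\<lambda>s::real. ennreal (s powr (\<delta> - 1)) * indicator {0..1} s"
  let ?B = "\<lambda>s::real. ennreal (s powr (- \<delta> - 1)) * indicator {1..} s"
  have "(\<integral>\<^sup>+s. ennreal (if s > 0 then inverse s * exp (- \<delta> * \<bar>ln s\<bar>) else 0) \<partial>lborel)
      \<le> (\<integral>\<^sup>+s. ?A s + ?B s \<partial>lborel)"
  proof (rule nn_integral_mono)
    fix s :: real
    show "ennreal (if s > 0 then inverse s * exp (- \<delta> * \<bar>ln s\<bar>) else 0) \<le> ?A s + ?B s"
    proof (cases "s \<le> 0")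
      case False
      have s: "inverse s * exp (c * ln s) = s powr (c - 1)" for c
        using False by (simp add: powr_def exp_diff left_diff_distrib field_simps)
      show ?thesis
        using False s[of \<delta>] s[of "- \<delta>"] by (cases "s \<le> 1") (auto simp: indicator_def)
    qed simp
  qed
  also have "\<dots> = (\<integral>\<^sup>+s. ?A s \<partial>lborel) + (\<integral>\<^sup>+s. ?B s \<partial>lborel)"
    by (rule nn_integral_add) auto
  also have "(\<integral>\<^sup>+s. ?A s \<partial>lborel) = ennreal (1 powr (\<delta> - 1 + 1) / (\<delta> - 1 + 1))"
    using assms by (intro nn_integral_has_integral_lebesgue' has_integral_powr_from_0) auto
  also have "(\<integral>\<^sup>+s. ?B s \<partial>lborel) = ennreal (- (1 powr (- \<delta> - 1 + 1)) / (- \<delta> - 1 + 1))"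
    using assms by (intro nn_integral_has_integral_lebesgue' has_integral_powr_to_inf) auto
  also have "ennreal (1 powr (\<delta> - 1 + 1) / (\<delta> - 1 + 1))
      + ennreal (- (1 powr (- \<delta> - 1 + 1)) / (- \<delta> - 1 + 1)) < \<infinity>"
    by simp
  finally show ?thesis .
qed

lemma prod_Basis_cart: "(\<Prod>b\<in>Basis. F (x \<bullet> b)) = (\<Prod>j\<in>UNIV. F (x $ j))" for x :: "real^'n"
proof -
  have "(\<Prod>b\<in>Basis. F (x \<bullet> b)) = (\<Prod>b\<in>range (\<lambda>j. axis j 1). F (x \<bullet> b))"
    by (intro prod.cong) (auto simp: Basis_vec_def)
  also have "\<dots> = (\<Prod>j\<in>UNIV. F (x \<bullet> axis j 1))"
    by (subst prod.reindex) (auto simp: inj_on_def axis_eq_axis)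
  finally show ?thesis
    by (simp add: inner_axis)
qed

lemma measurable_coordinate [measurable]: "(\<lambda>t::real^'n. t $ j) \<in> borel_measurable borel"
  by (intro borel_measurable_continuous_onI continuous_intros)

lemma canonical_measure_eq:
  fixes V :: "int^'k^'n"
  assumes W: "real_mat V ** W = mat 1"
  shows "canonical_measure V =
    density (restrict_space lborel pos_orthant) (\<lambda>t. ennreal (\<Prod>j\<in>UNIV. inverse (t $ j)))"
proof -
  let ?R = "restrict_space lborel (pos_orthant :: (real^'n) set)"
  have meas: "(\<lambda>t. ennreal (\<Prod>j\<in>UNIV. inverse (t $ j))) \<in> borel_measurable ?R"
    by (rule measurable_restrict_space1) simp
  have eq: "ennreal \<bar>canonical_form_X V t (\<chi> q. axis q 1)\<bar> = ennreal (\<Prod>j\<in>UNIV. inverse (t $ j))"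
    if "t \<in> space ?R" for t
    using that canonical_form_X_frame[OF W] by (simp add: space_restrict_space)
  show ?thesis
    unfolding canonical_measure_def X_pos_eq_pos_orthant[OF W]
  proof (rule density_cong)
    show "(\<lambda>t. ennreal \<bar>canonical_form_X V t (\<chi> q. axis q 1)\<bar>) \<in> borel_measurable ?R"
      using meas by (subst measurable_cong[OF eq])
  qed (use meas eq in auto)
qed

lemma pos_orthant_borel [measurable, simp]: "pos_orthant \<in> sets borel"
  by (intro borel_open open_pos_orthant)

lemma sets_canonical_measure: "sets (canonical_measure V) = sets (restrict_space borel (X_pos V))"
  unfolding canonical_measure_def by (simp add: sets_restrict_space)

lemma space_canonical_measure: "space (canonical_measure V) = X_pos V"
  by (simp add: canonical_measure_def space_restrict_space)

lemma nn_integral_canonical_measure: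
  fixes V :: "int^'k^'n"
  assumes W: "real_mat V ** W = mat 1" and \<phi>: "\<phi> \<in> borel_measurable (canonical_measure V)"
  shows "(\<integral>\<^sup>+t. \<phi> t \<partial>canonical_measure V)
    = (\<integral>\<^sup>+t. ennreal (\<Prod>j\<in>UNIV. inverse (t $ j)) * \<phi> t * indicator pos_orthant t \<partial>lborel)"
proof -
  let ?R = "restrict_space lborel (pos_orthant :: (real^'n) set)"
  have "\<phi> \<in> borel_measurable ?R"
    using \<phi> unfolding canonical_measure_eq[OF W] by simp
  moreover have "(\<lambda>t. ennreal (\<Prod>j\<in>UNIV. inverse (t $ j))) \<in> borel_measurable ?R"
    by (rule measurable_restrict_space1) simp
  ultimately show ?thesis
    unfolding canonical_measure_eq[OF W]
    by (simp add: nn_integral_density nn_integral_restrict_space)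
qed

text \<open>The density \<open>\<Prod>\<^sub>j 1 / t\<^sub>j\<close> and the bound are both products over the coordinates, so Tonelli's
 theorem reduces the claim to the one-dimensional integral.\<close>

lemma integrable_canonical_measure:
  fixes V :: "int^'k^'n" and r :: "real^'n \<Rightarrow> real"
  assumes W: "real_mat V ** W = mat 1" and "\<delta> > 0"
    and meas: "r \<in> borel_measurable (canonical_measure V)"
    and nonneg: "\<And>t. t \<in> pos_orthant \<Longrightarrow> 0 \<le> r t"
    and decay: "\<And>t. t \<in> pos_orthant \<Longrightarrow> r t \<le> (\<Prod>j\<in>UNIV. exp (- \<delta> * \<bar>ln (t $ j)\<bar>))"
  shows "integrable (canonical_measure V) r"
proof (rule integrableI_bounded[OF meas])
  let ?d = "\<lambda>s::real. if s > 0 then inverse s * exp (- \<delta> * \<bar>ln s\<bar>) else 0"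
  have "(\<integral>\<^sup>+t. ennreal (norm (r t)) \<partial>canonical_measure V)
      = (\<integral>\<^sup>+t. ennreal (\<Prod>j\<in>UNIV. inverse (t $ j)) * ennreal (norm (r t)) * indicator pos_orthant t \<partial>lborel)"
    using meas by (intro nn_integral_canonical_measure[OF W]) simp
  also have "\<dots> \<le> (\<integral>\<^sup>+t. (\<Prod>b\<in>Basis. ennreal (?d (t \<bullet> b))) \<partial>(lborel :: (real^'n) measure))"
  proof (rule nn_integral_mono)
    fix t :: "real^'n"
    show "ennreal (\<Prod>j\<in>UNIV. inverse (t $ j)) * ennreal (norm (r t)) * indicator pos_orthant t
        \<le> (\<Prod>b\<in>Basis. ennreal (?d (t \<bullet> b)))"
    proof (cases "t \<in> pos_orthant")
      case True
      then have pos: "t $ j > 0" for j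
        by (simp add: pos_orthant_def)
      have "(\<Prod>j\<in>UNIV. inverse (t $ j)) * r t
          \<le> (\<Prod>j\<in>UNIV. inverse (t $ j)) * (\<Prod>j\<in>UNIV. exp (- \<delta> * \<bar>ln (t $ j)\<bar>))"
        using pos by (intro mult_left_mono decay True prod_nonneg) (simp add: order_less_imp_le)
      also have "\<dots> = (\<Prod>j\<in>UNIV. ?d (t $ j))"
        using pos by (simp add: prod.distrib)
      finally have "ennreal ((\<Prod>j\<in>UNIV. inverse (t $ j)) * r t) \<le> ennreal (\<Prod>j\<in>UNIV. ?d (t $ j))"
        by (rule ennreal_leI)
      moreover have "ennreal (\<Prod>j\<in>UNIV. ?d (t $ j)) = (\<Prod>j\<in>UNIV. ennreal (?d (t $ j)))"
        by (rule prod_ennreal[symmetric]) simp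
      moreover have "ennreal ((\<Prod>j\<in>UNIV. inverse (t $ j)) * r t)
          = ennreal (\<Prod>j\<in>UNIV. inverse (t $ j)) * ennreal (r t)"
        using nonneg[OF True] by (rule ennreal_mult'')
      ultimately show ?thesis
        using True nonneg[OF True] by (simp add: prod_Basis_cart[where F = "\<lambda>s. ennreal (?d s)"])
    qed simp
  qed
  also have "\<dots> = (\<Prod>b\<in>(Basis :: (real^'n) set). \<integral>\<^sup>+s. ennreal (?d s) \<partial>lborel)"
    by (rule nn_integral_lborel_prod) auto
  also have "\<dots> < \<infinity>"
    using nn_integral_decay_finite[OF \<open>\<delta> > 0\<close>] by (simp add: power_less_top_ennreal)
  finally show "(\<integral>\<^sup>+t. ennreal (norm (r t)) \<partial>canonical_measure V) < \<infinity>" .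
qed

text \<open>A positive function with integral zero vanishes almost everywhere; since the density is
positive too, the orthant would be Lebesgue negligible, but it is open and nonempty.\<close>

lemma canonical_integral_pos:
  fixes V :: "int^'k^'n" and r :: "real^'n \<Rightarrow> real"
  assumes W: "real_mat V ** W = mat 1"
    and int: "integrable (canonical_measure V) r"
    and pos: "\<And>t. t \<in> pos_orthant \<Longrightarrow> 0 < r t"
  shows "0 < (\<integral>t. r t \<partial>canonical_measure V)"
proof -
  have space: "space (canonical_measure V) = pos_orthant"
    by (simp add: space_canonical_measure X_pos_eq_pos_orthant[OF W])
  have nonneg: "AE t in canonical_measure V. 0 \<le> r t"
    using pos by (intro AE_I2) (simp add: space order_less_imp_le)
  have "\<not> (AE t in canonical_measure V. r t = 0)"
  proof
    assume "AE t in canonical_measure V. r t = 0"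
    then have "AE t in canonical_measure V. False"
      using AE_space[of "canonical_measure V"] by eventually_elim (use pos space in force)
    then have "(\<integral>\<^sup>+t. 1 \<partial>canonical_measure V) = (\<integral>\<^sup>+t. 0 \<partial>canonical_measure V)"
      by (intro nn_integral_cong_AE) (auto elim: eventually_mono)
    then have "(\<integral>\<^sup>+t. 1 \<partial>canonical_measure V) = 0"
      by (simp only: nn_integral_const) simp
    then have "AE t in lborel. ennreal (\<Prod>j\<in>UNIV. inverse (t $ j)) * indicator (pos_orthant :: (real^'n) set) t = 0"
      unfolding nn_integral_canonical_measure[OF W borel_measurable_const] by (simp add: nn_integral_0_iff_AE)
    then have "AE t in lborel. t \<notin> (pos_orthant :: (real^'n) set)"
    proof eventually_elim
      case (elim t)
      show ?case
      proof
        assume t: "t \<in> pos_orthant"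
        then have "0 < (\<Prod>j\<in>UNIV. inverse (t $ j))"
          by (intro prod_pos) (simp add: pos_orthant_def)
        then have "ennreal (\<Prod>j\<in>UNIV. inverse (t $ j)) \<noteq> 0"
          by (simp only: ennreal_eq_0_iff not_le)
        then show False
          using elim t by (simp only: indicator_simps mult_1_right)
      qed
    qed
    then have "negligible (pos_orthant :: (real^'n) set)"
      by (simp add: negligible_iff_null_sets AE_iff_null_sets[symmetric] null_sets_completionI)
    moreover have "(pos_orthant :: (real^'n) set) \<noteq> {}"
      using exp_vec_pos by blast
    ultimately show False
      using open_not_negligible[OF open_pos_orthant] by blast
  qed
  then show ?thesis
    using integral_nonneg_eq_0_iff_AE[OF int nonneg] integral_nonneg_AE[OF nonneg] by simp
qed

section \<open>Measurability of descended functions\<close>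

lemma borel_measurable_section:
  "(\<lambda>t. exp_vec (W *v log_vec t)) \<in> borel_measurable borel" for W :: "real^'n^'k"
proof -
  have log: "log_vec \<in> borel_measurable (borel :: (real^'n) measure)"
    unfolding log_vec_def
    by (subst borel_measurable_euclidean_space) (auto simp: Basis_vec_def inner_axis)
  have "continuous_on UNIV (\<lambda>y. exp_vec (W *v y))"
    unfolding exp_vec_def by (intro continuous_intros)
  then show ?thesis
    using measurable_compose[OF log borel_measurable_continuous_onI] by blast
qed

lemma borel_measurable_monom_eval [measurable]:
  "(monom_eval l :: real^'k \<Rightarrow> real) \<in> borel_measurable borel"
  unfolding monom_eval_def by measurable

lemma borel_measurable_trop [measurable]: "trop f \<in> borel_measurable borel"
  unfolding trop_def by measurable

lemma borel_measurable_real_eval [measurable]: "real_eval f \<in> borel_measurable borel"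
  unfolding real_eval_eq by measurable

lemma borel_measurable_descend:
  fixes V :: "int^'k^'n"
  assumes W: "real_mat V ** W = mat 1" and F: "F \<in> borel_measurable borel"
    and fibres: "\<And>x y. x \<in> pos_orthant \<Longrightarrow> y \<in> pos_orthant \<Longrightarrow> cox_map V x = cox_map V y \<Longrightarrow> F x = F y"
  shows "descend V F \<in> borel_measurable (canonical_measure V)"
proof -
  let ?sec = "\<lambda>t. exp_vec (W *v log_vec t)"
  have meas: "(\<lambda>t. F (?sec t)) \<in> borel_measurable (canonical_measure V)"
    using measurable_restrict_space1[OF measurable_compose[OF borel_measurable_section F]]
    by (simp add: measurable_cong_sets[OF sets_canonical_measure refl])
  have eq: "descend V F t = F (?sec t)" if "t \<in> space (canonical_measure V)" for t
  proof -
    have t: "t \<in> pos_orthant"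
      using that by (simp add: space_canonical_measure X_pos_eq_pos_orthant[OF W])
    have "descend V F (cox_map V (?sec t)) = F (?sec t)"
      by (rule descend_cox_map[OF fibres exp_vec_pos])
    then show ?thesis
      by (simp add: cox_map_section[OF W t])
  qed
  show ?thesis
    using meas by (subst measurable_cong[OF eq])
qed

section \<open>Bounds by the tropicalization\<close>

text \<open>A polynomial with positive coefficients dominates its term of largest monomial, and is at
most its tropicalization times the sum of the coefficients.\<close>

lemma real_eval_lower:
  assumes f: "f \<noteq> 0" "positive_coeffs f" and x: "x \<in> pos_orthant"
  shows "(MIN l\<in>supp f. Re (cf f l)) * trop f x \<le> real_eval f x"
proof -
  obtain l where l: "l \<in> supp f" "trop f x = monom_eval l x"
    using trop_attained[OF f(1)] by blast
  have "(MIN l\<in>supp f. Re (cf f l)) * trop f x \<le> Re (cf f l) * monom_eval l x"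
    unfolding l(2) using l(1) monom_eval_pos[OF x] by (intro mult_right_mono) (auto simp: order_less_imp_le)
  also have "\<dots> \<le> real_eval f x"
    unfolding real_eval_eq using f(2) monom_eval_pos[OF x] l(1)
    by (intro member_le_sum) (auto simp: positive_coeffs_def order_less_imp_le)
  finally show ?thesis .
qed

lemma real_eval_upper:
  assumes "positive_coeffs g"
  shows "real_eval g x \<le> (\<Sum>l\<in>supp g. Re (cf g l)) * trop g x"
  unfolding real_eval_eq sum_distrib_right
proof (rule sum_mono)
  fix l
  assume l: "l \<in> supp g"
  then have "0 \<le> Re (cf g l)"
    using assms by (simp add: positive_coeffs_def order_less_imp_le)
  then show "Re (cf g l) * monom_eval l x \<le> Re (cf g l) * trop g x"
    by (rule mult_left_mono[OF monom_le_trop[OF l]])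
qed

lemma Min_coeff_pos:
  assumes "f \<noteq> 0" "positive_coeffs f"
  shows "0 < (MIN l\<in>supp f. Re (cf f l))"
proof -
  have "(MIN l\<in>supp f. Re (cf f l)) \<in> (\<lambda>l. Re (cf f l)) ` supp f"
    using assms(1) by (intro Min_in) auto
  then show ?thesis
    using assms(2) by (auto simp: positive_coeffs_def)
qed

lemma Min_coeff_le_sum:
  assumes "f \<noteq> 0" "positive_coeffs f"
  shows "(MIN l\<in>supp f. Re (cf f l)) \<le> (\<Sum>l\<in>supp f. Re (cf f l))"
proof -
  obtain l where l: "l \<in> supp f"
    using assms(1) by (metis keys_eq_empty all_not_in_conv)
  then have "(MIN l\<in>supp f. Re (cf f l)) \<le> Re (cf f l)"
    by simp
  also have "\<dots> \<le> (\<Sum>l\<in>supp f. Re (cf f l))"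
    using assms(2) l by (intro member_le_sum) (auto simp: positive_coeffs_def order_less_imp_le)
  finally show ?thesis .
qed

section \<open>Rejection sampling\<close>

text \<open>A proposal is certainly accepted when the threshold falls below the lower bound \<open>m\<close> of \<open>h\<close>,
an event of probability \<open>m / M\<close> that is independent of the proposal.\<close>

lemma rejection_sampling_acceptance:
  fixes P :: "'a measure" and h :: "'a \<Rightarrow> real"
  assumes P: "prob_space P" and h: "h \<in> borel_measurable P"
    and lower: "\<And>t. t \<in> space P \<Longrightarrow> m \<le> h t" and m: "0 \<le> m" "m \<le> M" "0 < M"
  defines "Q \<equiv> P \<Otimes>\<^sub>M uniform_measure lborel {0..M}"
  shows "m / M \<le> measure Q {(t, \<xi>) \<in> space Q. \<xi> < h t}"
proof -
  let ?U = "uniform_measure lborel {0..M}"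
  interpret P: prob_space P by fact
  interpret U: prob_space ?U
    using m by (intro prob_space_uniform_measure) auto
  interpret PU: pair_prob_space P ?U ..
  have space: "space Q = space P \<times> UNIV"
    by (simp add: Q_def space_pair_measure)
  have "emeasure ?U {..<m} = emeasure lborel {0..<m} / emeasure lborel {0..M}"
  proof -
    have "{0..M} \<inter> {..<m} = {0..<m}"
      using m by auto
    then show ?thesis by simp
  qed
  then have "measure ?U {..<m} = m / M"
    using m by (simp add: measure_def divide_ennreal)
  then have "m / M = measure Q (space P \<times> {..<m})"
    unfolding Q_def by (simp add: measure_def U.emeasure_pair_measure_Times P.emeasure_space_1)
  also have "\<dots> \<le> measure Q {(t, \<xi>) \<in> space Q. \<xi> < h t}"
    unfolding Q_def
  proof (rule PU.finite_measure_mono)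
    show "space P \<times> {..<m} \<subseteq> {(t, \<xi>) \<in> space (P \<Otimes>\<^sub>M ?U). \<xi> < h t}"
      using lower by (force simp: space_pair_measure)
    have "{z \<in> space (P \<Otimes>\<^sub>M ?U). snd z < h (fst z)} \<in> sets (P \<Otimes>\<^sub>M ?U)"
      using h by measurable
    then show "{(t, \<xi>) \<in> space (P \<Otimes>\<^sub>M ?U). \<xi> < h t} \<in> sets (P \<Otimes>\<^sub>M ?U)"
      by (simp add: case_prod_beta')
  qed
  finally show ?thesis .
qed

theorem proposition4p3:
  fixes \<F> :: "(real^'n) set set"
    and V :: "int^'k^'n"
    and f g :: "'k cox_ring"
    and d :: "(int^'k) set"
    and M1 M2 :: real
  assumes "complete_rational_fan \<F>"
    and "ray_matrix \<F> V"
    and "f \<noteq> 0" and "g \<noteq> 0"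
    and "positive_coeffs f" and "positive_coeffs g"
    and "d \<in> Cl V" and "homogeneous V d f" and "homogeneous V d g"
    and "aff_dim (newton_polytope g) = int CARD('n)"
    and "newton_polytope f \<subseteq> rel_interior (newton_polytope g)"
    and "M1 = (MIN l\<in>supp f. Re (cf f l)) / (\<Sum>l\<in>supp g. Re (cf g l))"
    and "M2 = (\<Sum>l\<in>supp f. Re (cf f l)) / (MIN l\<in>supp g. Re (cf g l))"
  shows "acceptance_rate V f g M2 \<ge> M1 / M2"
proof -
  note f = \<open>f \<noteq> 0\<close> \<open>positive_coeffs f\<close> \<open>homogeneous V d f\<close>
  note g = \<open>g \<noteq> 0\<close> \<open>positive_coeffs g\<close> \<open>homogeneous V d g\<close>
  let ?\<mu> = "canonical_measure V" and ?r = "trop_ratio V f g" and ?h = "h_fun V f g"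
  obtain l0 where "l0 \<in> supp g"
    using g(1) by (metis keys_eq_empty all_not_in_conv)
  then have "surj ((*v) (real_mat V))"
    using affine_hull_exponents(1)[OF g(3)] assms(10) by blast
  then obtain W where W: "real_mat V ** W = mat 1"
    unfolding matrix_right_invertible_surjective[symmetric] by blast
  have pos: "space ?\<mu> = pos_orthant"
    by (simp add: space_canonical_measure X_pos_eq_pos_orthant[OF W])
  let ?R = "\<lambda>x. trop f x / trop g x"
  let ?H = "\<lambda>x. real_eval f x * trop g x / (real_eval g x * trop f x)"
  have R: "?R x = ?R y" and H: "?H x = ?H y"
    if xy: "x \<in> pos_orthant" "y \<in> pos_orthant" "cox_map V x = cox_map V y" for x y
  proof -
    obtain c where "c > 0"
      "\<And>f. homogeneous V d f \<Longrightarrow> real_eval f x = c * real_eval f y"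
      "\<And>f. homogeneous V d f \<Longrightarrow> f \<noteq> 0 \<Longrightarrow> trop f x = c * trop f y"
      using homogeneous_scale_on_fibres[OF xy] by blast
    then show "?R x = ?R y" "?H x = ?H y"
      using f(1,3) g(1,3) by simp_all
  qed
  have meas: "?r \<in> borel_measurable ?\<mu>" "?h \<in> borel_measurable ?\<mu>"
    unfolding trop_ratio_def h_fun_def
    by (intro borel_measurable_descend[OF W] R H; measurable)+
  have r_eq: "?r (cox_map V x) = ?R x" if "x \<in> pos_orthant" for x
    unfolding trop_ratio_def by (rule descend_cox_map[OF R that])
  have h_eq: "?h (cox_map V x) = ?H x" if "x \<in> pos_orthant" for x
    unfolding h_fun_def by (rule descend_cox_map[OF H that])
  have lift: "\<exists>x\<in>pos_orthant. cox_map V x = t \<and> ?r t = ?R x \<and> ?h t = ?H x"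
    if t: "t \<in> pos_orthant" for t
  proof -
    obtain x where x: "x \<in> pos_orthant" "cox_map V x = t"
      using cox_map_section[OF W t] exp_vec_pos by blast
    then show ?thesis
      using r_eq[OF x(1)] h_eq[OF x(1)] by (intro bexI[of _ x]) simp_all
  qed
  have r_pos: "0 < ?r t" if "t \<in> pos_orthant" for t
    using lift[OF that] trop_pos[OF f(1)] trop_pos[OF g(1)] by auto
  obtain \<delta> where \<delta>: "\<delta> > 0" "\<And>x. x \<in> pos_orthant \<Longrightarrow>
      ?R x \<le> (\<Prod>j\<in>UNIV. exp (- \<delta> * \<bar>ln (cox_map V x $ j)\<bar>))"
    using trop_ratio_decay[OF g(3,1) f(1) assms(10,11)] by blast
  have int: "integrable ?\<mu> ?r"
  proof (rule integrable_canonical_measure[OF W \<delta>(1) meas(1)])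
    show "0 \<le> ?r t" if "t \<in> pos_orthant" for t
      using r_pos[OF that] by simp
    show "?r t \<le> (\<Prod>j\<in>UNIV. exp (- \<delta> * \<bar>ln (t $ j)\<bar>))" if "t \<in> pos_orthant" for t
      using lift[OF that] \<delta>(2) by metis
  qed
  define I where "I = trop_integral V f g"
  have I: "I > 0"
    unfolding I_def trop_integral_def by (rule canonical_integral_pos[OF W int r_pos])
  let ?A = "MIN l\<in>supp f. Re (cf f l)" and ?B = "\<Sum>l\<in>supp g. Re (cf g l)"
  have coeffs: "0 < ?A" "0 < (MIN l\<in>supp g. Re (cf g l))" "0 < ?B"
    using Min_coeff_pos[OF f(1,2)] Min_coeff_pos[OF g(1,2)] Min_coeff_le_sum[OF g(1,2)] by linarith+
  let ?P = "trop_measure V f g"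
  have "prob_space ?P"
  proof
    have "emeasure ?P (space ?P) = (\<integral>\<^sup>+t. ennreal (1 / I * ?r t) \<partial>?\<mu>)"
      unfolding trop_measure_def I_def[symmetric] using meas(1) by (simp add: emeasure_density cong: nn_integral_cong)
    also have "\<dots> = ennreal (\<integral>t. 1 / I * ?r t \<partial>?\<mu>)"
      using int I r_pos by (intro nn_integral_eq_integral AE_I2) (auto simp: pos order_less_imp_le)
    also have "(\<integral>t. 1 / I * ?r t \<partial>?\<mu>) = 1"
      using I int by (simp add: I_def trop_integral_def)
    finally show "emeasure ?P (space ?P) = 1" by simp
  qed
  moreover have "?h \<in> borel_measurable ?P"
    using meas(2) by (simp add: trop_measure_def)
  moreover have "M1 \<le> ?h t" if "t \<in> space ?P" for t
  proof -
    have "t \<in> pos_orthant"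
      using that pos by (simp add: trop_measure_def)
    then obtain x where x: "x \<in> pos_orthant" "?h t = ?H x"
      using lift by blast
    note trop = trop_pos[OF f(1) x(1)] trop_pos[OF g(1) x(1)]
    have lower: "?A * trop f x \<le> real_eval f x"
      by (rule real_eval_lower[OF f(1,2) x(1)])
    have upper: "real_eval g x \<le> ?B * trop g x"
      by (rule real_eval_upper[OF g(2)])
    have g_pos: "0 < real_eval g x"
      using real_eval_lower[OF g(1,2) x(1)] coeffs(2) trop(2) by (meson less_le_trans mult_pos_pos)
    have "(?A * trop f x) * real_eval g x \<le> real_eval f x * (?B * trop g x)"
      using lower upper coeffs(1) trop g_pos by (intro mult_mono) (auto intro: order_trans[rotated])
    then have "?A / ?B \<le> ?H x"
      using coeffs(3) trop g_pos by (simp add: field_simps)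
    then show ?thesis
      by (simp add: x(2) assms(12))
  qed
  moreover have "0 \<le> M1" "M1 \<le> M2" "0 < M2"
    using coeffs Min_coeff_le_sum[OF f(1,2)] Min_coeff_le_sum[OF g(1,2)]
    unfolding assms(12,13) by (auto intro!: frac_le divide_pos_pos)
  ultimately have "M1 / M2 \<le> measure (?P \<Otimes>\<^sub>M uniform_measure lborel {0..M2})
      {(t, \<xi>) \<in> space (?P \<Otimes>\<^sub>M uniform_measure lborel {0..M2}). \<xi> < ?h t}"
    by (rule rejection_sampling_acceptance)
  then show ?thesis
    by (simp add: acceptance_rate_def Let_def)
qed

end
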